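(* Let $(\mathbf{k}_1;\mathbf{m}_1)$ and $(\mathbf{k}_2;\mathbf{m}_2)$ be positive bi-indices. Then for all $0<t<1$, $$\mathrm{Li}^{\mu}(\mathbf{k}_1;\mathbf{m}_1;t)\cdot\mathrm{Li}^{\mu}(\mathbf{k}_2;\mathbf{m}_2;t)=\sum_{(\mathbf{k};\mathbf{m})}\sqcup\!\sqcup\big(\mathrm{bs}(\mathbf{k}_1;\mathbf{m}_1),\mathrm{bs}(\mathbf{k}_2;\mathbf{m}_2);\mathrm{bs}(\mathbf{k};\mathbf{m})\big)\,\mathrm{Li}^{\mu}(\mathbf{k};\mathbf{m};t),$$ where the sum runs over all positive bi-indices $(\mathbf{k};\mathbf{m})$ (only finitely many terms are nonzero).
   Context: Fix $\mu\in\mathbb{C}$, $\mathrm{Re}(\mu)>0$. A bi-index $(\mathbf{k};\mathbf{m})=(k_1,\dots,k_r;m_1,\dots,m_r)\in\mathbb{N}^r\times\mathbb{Q}^r$ is positive if all $m_i>0$. $\mathrm{Li}^{\mu}(\mathbf{k};\mathbf{m};t)=\sum_{0\le n_1\le\cdots\le n_r}\frac{\mu^rt^{n_r\mu}}{(n_1\mu+m_1)^{k_1}\cdots(n_r\mu+m_r)^{k_r}}$ ($0\le t<1$). The binary sequence of a positive bi-index is the pair of sequences of length $|\mathbf{k}|$ $\mathrm{bs}(\mathbf{k};\mathbf{m})=(1,0_{k_1-1},1,0_{k_2-1},\dots,1,0_{k_r-1};\ m_1,0_{k_1-1},m_2-m_1,0_{k_2-1},\dots,m_r-m_{r-1},0_{k_r-1})$,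 where $0_j$ denotes $j$ consecutive zeros. A shuffle of type $(r,s)$ is a permutation $\sigma$ of $\{1,\dots,r+s\}$ with $\sigma(1)<\dots<\sigma(r)$ and $\sigma(r+1)<\dots<\sigma(r+s)$. For sequence pairs $(\mathbf{s}_1;\boldsymbol\tau_1)=(s_1,\dots,s_r;\tau_1,\dots,\tau_r)$, $(\mathbf{s}_2;\boldsymbol\tau_2)=(s_{r+1},\dots,s_{r+s};\tau_{r+1},\dots,\tau_{r+s})$ and $(\mathbf{s};\boldsymbol\tau)$, $\sqcup\!\sqcup((\mathbf{s}_1;\boldsymbol\tau_1),(\mathbf{s}_2;\boldsymbol\tau_2);(\mathbf{s};\boldsymbol\tau))$ is the number of shuffles $\sigma$ of type $(r,s)$ with $(\mathbf{s};\boldsymbol\tau)=(s_{\sigma^{-1}(1)},\dots,s_{\sigma^{-1}(r+s)};\tau_{\sigma^{-1}(1)},\dots,\tau_{\sigma^{-1}(r+s)})$. *)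

theory Defs
  imports "HOL-Analysis.Analysis" "HOL-Combinatorics.Permutations"
begin

text \<open>All sequences are lists, so positions are counted from 0 instead of 1.\<close>

type_synonym bi_index = "nat list \<times> rat list"

text \<open>The depth is at least 1 (the series below refers to the last summation index),
  and the entries of the first component are at least 1.\<close>

fun is_bi_index :: "bi_index \<Rightarrow> bool" where
  "is_bi_index (k, m) \<longleftrightarrow> k \<noteq> [] \<and> length m = length k \<and> (\<forall>x\<in>set k. 1 \<le> x)"

fun positive_bi_index :: "bi_index \<Rightarrow> bool" where
  "positive_bi_index (k, m) \<longleftrightarrow> is_bi_index (k, m) \<and> (\<forall>x\<in>set m. 0 < x)"

text \<open>The power of t with exponent n times mu is written as the n-th power of
  \<^term>\<open>complex_of_real t powr \<mu>\<close>; for t > 0 the two agree, and for t = 0 this form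
  yields the intended value 1 at n = 0, whereas \<^term>\<open>0 powr (0 :: complex) = 0\<close>.\<close>

fun Li :: "complex \<Rightarrow> bi_index \<Rightarrow> real \<Rightarrow> complex" where
  "Li \<mu> (k, m) t =
     (\<Sum>\<^sub>\<infinity> n \<in> {n :: nat list. length n = length k \<and> sorted n}.
        \<mu> ^ length k * (complex_of_real t powr \<mu>) ^ last n
        / (\<Prod>i<length k. (of_nat (n ! i) * \<mu> + of_rat (m ! i)) ^ (k ! i)))"

definition successive_diffs :: "rat list \<Rightarrow> rat list" where
  "successive_diffs m = map (\<lambda>i. if i = 0 then m ! 0 else m ! i - m ! (i - 1)) [0..<length m]"

fun bs :: "bi_index \<Rightarrow> nat list \<times> rat list" where
  "bs (k, m) =
     (concat (map (\<lambda>ki. 1 # replicate (ki - 1) 0) k),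
      concat (map2 (\<lambda>ki d. d # replicate (ki - 1) 0) k (successive_diffs m)))"

definition is_shuffle :: "nat \<Rightarrow> nat \<Rightarrow> (nat \<Rightarrow> nat) \<Rightarrow> bool" where
  "is_shuffle r s \<sigma> \<longleftrightarrow>
     \<sigma> permutes {..<r + s} \<and> strict_mono_on {..<r} \<sigma> \<and> strict_mono_on {r..<r + s} \<sigma>"

text \<open>Intended for pairs of lists of equal length.\<close>

fun shuffle_count ::
    "'a list \<times> 'b list \<Rightarrow> 'a list \<times> 'b list \<Rightarrow> 'a list \<times> 'b list \<Rightarrow> nat" where
  "shuffle_count (s1, \<tau>1) (s2, \<tau>2) (s, \<tau>) =
     card {\<sigma>. is_shuffle (length s1) (length s2) \<sigma> \<and>
              s = map (\<lambda>j. (s1 @ s2) ! (inv \<sigma> j)) [0..<length s1 + length s2] \<and>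
              \<tau> = map (\<lambda>j. (\<tau>1 @ \<tau>2) ! (inv \<sigma> j)) [0..<length s1 + length s2]}"

end

theory Submission
  imports Defs "HOL-Computational_Algebra.Formal_Power_Series"
begin

text \<open>
  Put \<open>x = t\<^sup>\<mu>\<close>. Up to the factor \<open>t\<close> to the power \<open>m\<^sub>r\<close>, the function \<open>Li\<close> is an iterated integral of the
  forms \<open>\<mu> t\<^bsup>d - 1\<^esup> dt / (1 - t\<^sup>\<mu>)\<close> for the letters \<open>(1, d)\<close> and \<open>dt / t\<close> for the letter \<open>(0, 0)\<close> of
  its binary sequence, and iterated integrals multiply by shuffling. The argument becomes purely
  algebraic once \<open>Li\<close> is expanded as a power series in \<open>x\<close>: the operator \<open>t d/dt\<close> acts on
  \<open>t\<^sup>c x\<^sup>n\<close> as multiplication by \<open>n \<mu> + c\<close>, it satisfies the Leibniz rule, and it is injective for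
  \<open>c > 0\<close>, so that the shuffle formula follows by induction on the last letters of the two words.
\<close>

section \<open>Power series of words\<close>

definition weight :: "(nat \<times> rat) list \<Rightarrow> rat" where
  "weight w = sum_list (map snd w)"

lemma weight_simps [simp]:
  "weight [] = 0" "weight (a # w) = snd a + weight w" "weight (v @ w) = weight v + weight w"
  "weight (replicate n (x, 0)) = 0"
  by (simp_all add: weight_def sum_list_replicate)

text \<open>Words are written in reverse: the head of the list is the last letter of the binary sequence.
  Positivity of the weights forces the first letter of the sequence to be of the form \<open>(1, d)\<close>, so
  the nonempty admissible words are exactly the binary sequences of positive bi-indices.\<close>

fun admissible :: "(nat \<times> rat) list \<Rightarrow> bool" where
  "admissible [] \<longleftrightarrow> True"
| "admissible (a # w) \<longleftrightarrow>
     (fst a = 1 \<or> a = (0, 0)) \<and> 0 < weight (a # w) \<and> admissible w"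

lemma weight_shuffles: "w \<in> shuffles u v \<Longrightarrow> weight w = weight u + weight v"
  by (induction u v arbitrary: w rule: shuffles.induct) auto

text \<open>A tail of a shuffle is a shuffle of tails of the two words, and weights add, so
  positivity is inherited. Hence shuffling two binary sequences leads only to binary
  sequences.\<close>

lemma admissible_shuffles:
  "w \<in> shuffles u v \<Longrightarrow> admissible u \<Longrightarrow> admissible v \<Longrightarrow> admissible w"
proof (induction u v arbitrary: w rule: shuffles.induct)
  case (3 a u b v)
  have "0 < weight w"
    using weight_shuffles[OF "3.prems"(1)] "3.prems"(2,3) by auto
  with 3 show ?case by auto
qed auto

lemma map_in_shuffles:
  "zs \<in> shuffles xs ys \<Longrightarrow> map g zs \<in> shuffles (map g xs) (map g ys)"
  by (induction xs ys arbitrary: zs rule: shuffles.induct) auto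

text \<open>A letter \<open>(1, d)\<close> contributes the geometric series of
  \<open>\<mu> / (1 - X)\<close>. The power \<open>t^d\<close> from its form is not stored here;
  \<open>weight\<close> accounts for it.\<close>

definition letter_fps :: "complex \<Rightarrow> nat \<times> rat \<Rightarrow> complex fps" where
  "letter_fps \<mu> a = (if fst a = 0 then 1 else fps_const \<mu> * Abs_fps (\<lambda>_. 1))"

text \<open>Prepending a letter multiplies by its form and integrates from 0. With \<open>c\<close>
  the weight of the new word, integrating \<open>t^(n\<mu> + c) dt/t\<close> divides coefficient
  \<open>n\<close> by \<open>n\<mu> + c\<close>.\<close>

fun word_fps :: "complex \<Rightarrow> (nat \<times> rat) list \<Rightarrow> complex fps" where
  "word_fps \<mu> [] = 1"
| "word_fps \<mu> (a # w) = Abs_fps (\<lambda>n. fps_nth (letter_fps \<mu> a * word_fps \<mu> w) n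
     / (of_nat n * \<mu> + of_rat (weight (a # w))))"

text \<open>The action of \<open>t d/dt\<close> on \<open>f\<close>, where \<open>f\<close> stands for the function \<open>t\<^sup>c f(t\<^sup>\<mu>)\<close>.\<close>

definition euler_op :: "complex \<Rightarrow> complex \<Rightarrow> complex fps \<Rightarrow> complex fps" where
  "euler_op \<mu> c f = fps_const \<mu> * (fps_X * fps_deriv f) + fps_const c * f"

lemma euler_op_nth: "fps_nth (euler_op \<mu> c f) n = (of_nat n * \<mu> + c) * fps_nth f n"
  by (cases n) (auto simp: euler_op_def algebra_simps)

lemma euler_op_mult: "euler_op \<mu> (c + d) (f * g) = euler_op \<mu> c f * g + f * euler_op \<mu> d g"
  by (simp add: euler_op_def algebra_simps flip: fps_const_add)

lemma euler_op_sum: "euler_op \<mu> c (\<Sum>i\<in>I. f i) = (\<Sum>i\<in>I. euler_op \<mu> c (f i))"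
  by (rule fps_ext) (simp add: euler_op_nth fps_sum_nth sum_distrib_left)

lemma denominator_Re:
  assumes "0 \<le> Re \<mu>"
  shows "of_rat q \<le> Re (of_nat n * \<mu> + of_rat q)"
proof -
  \<comment> \<open>The two \<open>of_rat\<close> have different targets, complex on the left and
    real on the right; writing \<open>q\<close> as a fraction of integers compares them.\<close>
  have "Re (of_rat q) = of_rat q"
  proof (cases q)
    case (Fract a b)
    then have "(of_rat q :: complex) = of_real (of_rat q)" by (simp add: of_rat_rat)
    then show ?thesis by simp
  qed
  with assms show ?thesis by simp
qed

text \<open>The bound is uniform in \<open>n\<close>. It serves twice: for nonvanishing denominators
  and for the majorant of the series.\<close>

lemma denominator_norm:
  assumes "0 \<le> Re \<mu>"
  shows "of_rat q \<le> norm (of_nat n * \<mu> + of_rat q)"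
  using denominator_Re[OF assms] complex_Re_le_cmod by (rule order_trans)

lemma denominator_nonzero:
  assumes "0 \<le> Re \<mu>" "0 < q"
  shows "of_nat n * \<mu> + of_rat q \<noteq> (0 :: complex)"
proof -
  have "(0 :: real) < of_rat q" using assms by simp
  then show ?thesis using denominator_norm[OF assms(1), of q n] by auto
qed

lemma euler_op_inject:
  assumes "0 \<le> Re \<mu>" "0 < q" "euler_op \<mu> (of_rat q) f = euler_op \<mu> (of_rat q) g"
  shows "f = g"
proof (rule fps_ext)
  fix n
  have "(of_nat n * \<mu> + of_rat q) * fps_nth f n = (of_nat n * \<mu> + of_rat q) * fps_nth g n"
    using assms(3) by (metis euler_op_nth)
  then show "fps_nth f n = fps_nth g n"
    using denominator_nonzero[OF assms(1,2)] by simp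
qed

text \<open>The operator undoes the division in \<open>word_fps\<close> and so strips the head
  letter. The weight enters as a variable \<open>q\<close>, which lets it be supplied as a
  sum.\<close>

lemma euler_op_word_fps:
  assumes "0 \<le> Re \<mu>" "0 < weight (a # w)" "q = weight (a # w)"
  shows "euler_op \<mu> (of_rat q) (word_fps \<mu> (a # w)) = letter_fps \<mu> a * word_fps \<mu> w"
  using denominator_nonzero[OF assms(1,2)] assms(3)
  by (intro fps_ext) (simp add: euler_op_nth del: weight_simps)

text \<open>\<open>shuffles\<close> is a set and forgets multiplicities of equal words. Shuffling
  disjoint labels and reading them through \<open>g\<close> keeps them. Both sides have the same
  image under the injective \<open>euler_op\<close>.\<close>

lemma word_fps_mult:
  fixes g :: "'a \<Rightarrow> nat \<times> rat"
  assumes "0 \<le> Re \<mu>"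
  shows "admissible (map g xs) \<Longrightarrow> admissible (map g ys) \<Longrightarrow> set xs \<inter> set ys = {} \<Longrightarrow>
    word_fps \<mu> (map g xs) * word_fps \<mu> (map g ys) = (\<Sum>zs\<in>shuffles xs ys. word_fps \<mu> (map g zs))"
proof (induction xs ys rule: shuffles.induct)
  case (3 x xs y ys)
  let ?W = "\<lambda>zs. word_fps \<mu> (map g zs)"
  define p where "p = weight (map g (x # xs))"
  define q where "q = weight (map g (y # ys))"
  have pos: "0 < p" "0 < q"
    using "3.prems" by (auto simp: p_def q_def)
  have E: "euler_op \<mu> (of_rat (p + q)) (?W (z # zs)) = letter_fps \<mu> (g z) * ?W zs"
    if "z # zs \<in> shuffles (x # xs) (y # ys)" for z zs
  proof -
    have "weight (map g (z # zs)) = p + q"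
      using weight_shuffles[OF map_in_shuffles[OF that]] by (simp add: p_def q_def)
    with pos show ?thesis
      unfolding list.map by (intro euler_op_word_fps[OF assms]) (simp_all only: add_pos_pos)
  qed
  \<comment> \<open>The head of a shuffle reveals which list it came from, since the labels are
    disjoint; the two families therefore do not overlap.\<close>
  have split: "(\<Sum>zs\<in>shuffles (x # xs) (y # ys). f zs) =
      (\<Sum>zs\<in>shuffles xs (y # ys). f (x # zs)) + (\<Sum>zs\<in>shuffles (x # xs) ys. f (y # zs))"
    for f :: "'a list \<Rightarrow> complex fps"
  proof -
    have "x \<noteq> y" using "3.prems"(3) by auto
    then have "(#) x ` shuffles xs (y # ys) \<inter> (#) y ` shuffles (x # xs) ys = {}" by auto
    then show ?thesis
      by (simp add: sum.union_disjoint sum.reindex)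
  qed
  \<comment> \<open>By Leibniz the operator hits one factor at a time and strips its head, which
    leaves products covered by the induction hypotheses.\<close>
  have "euler_op \<mu> (of_rat (p + q)) (?W (x # xs) * ?W (y # ys)) =
      letter_fps \<mu> (g x) * (?W xs * ?W (y # ys)) + letter_fps \<mu> (g y) * (?W (x # xs) * ?W ys)"
    using euler_op_word_fps[OF assms, of "g x" "map g xs" p]
      euler_op_word_fps[OF assms, of "g y" "map g ys" q] pos
    by (simp only: of_rat_add euler_op_mult list.map p_def q_def) (simp only: mult_ac)
  also have "?W xs * ?W (y # ys) = (\<Sum>zs\<in>shuffles xs (y # ys). ?W zs)"
    using "3.prems" by (intro "3.IH"(1)) auto
  also have "?W (x # xs) * ?W ys = (\<Sum>zs\<in>shuffles (x # xs) ys. ?W zs)"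
    using "3.prems" by (intro "3.IH"(2)) auto
  also have "letter_fps \<mu> (g x) * (\<Sum>zs\<in>shuffles xs (y # ys). ?W zs) +
        letter_fps \<mu> (g y) * (\<Sum>zs\<in>shuffles (x # xs) ys. ?W zs) =
      euler_op \<mu> (of_rat (p + q)) (\<Sum>zs\<in>shuffles (x # xs) (y # ys). ?W zs)"
    unfolding euler_op_sum unfolding split sum_distrib_left
    by (intro arg_cong2[where f = "(+)"] sum.cong refl E[symmetric]) auto
  finally show ?case
    by (rule euler_op_inject[OF assms add_pos_pos[OF pos]])
qed auto

section \<open>Shuffles as permutations\<close>

lemma sorted_wrt_filter_iff:
  "sorted_wrt R (filter P xs) \<longleftrightarrow> sorted_wrt (\<lambda>x y. P x \<and> P y \<longrightarrow> R x y) xs"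
  by (induction xs) auto

text \<open>Disjointness lets filtering by membership in \<open>xs\<close> recover both parts, and
  filtering commutes with reversal.\<close>

lemma rev_in_shuffles:
  assumes "set xs \<inter> set ys = {}" "zs \<in> shuffles xs ys"
  shows "rev zs \<in> shuffles (rev xs) (rev ys)"
proof -
  have "filter (\<lambda>x. x \<in> set xs) (rev zs) = rev xs" "filter (\<lambda>x. x \<notin> set xs) (rev zs) = rev ys"
    using filter_shuffles_disjoint1[OF assms] by (simp_all flip: rev_filter)
  then show ?thesis
    using partition_in_shuffles[of "rev zs" "\<lambda>x. x \<in> set xs"] by simp
qed

lemma bij_betw_rev_shuffles:
  assumes "set xs \<inter> set ys = {}"
  shows "bij_betw rev (shuffles xs ys) (shuffles (rev xs) (rev ys))"
proof (rule bij_betw_byWitness[where f' = rev])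
  show "rev ` shuffles (rev xs) (rev ys) \<subseteq> shuffles xs ys"
    using rev_in_shuffles[of "rev xs" "rev ys"] assms by auto
qed (use rev_in_shuffles[OF assms] in auto)

text \<open>Every list is a shuffle of its entries below \<open>r\<close> and the remaining ones. A
  strictly increasing list is determined by its set, so these parts are the two intervals.\<close>

lemma shuffles_upt_iff:
  "p \<in> shuffles [0..<r] [r..<r + s] \<longleftrightarrow>
     distinct p \<and> set p = {..<r + s} \<and>
     sorted_wrt (\<lambda>x y. (x < r \<and> y < r) \<or> (r \<le> x \<and> r \<le> y) \<longrightarrow> x < y) p" (is "?L \<longleftrightarrow> ?R")
proof
  assume p: ?L
  have "set p = {..<r + s}" using set_shuffles[OF p] by (simp add: lessThan_atLeast0 ivl_disj_un)
  moreover have "distinct p" by (rule distinct_disjoint_shuffles[OF _ _ _ p]) auto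
  moreover have disj: "set [0..<r] \<inter> set [r..<r + s] = {}" by auto
  have "filter (\<lambda>x. x < r) p = [0..<r]" "filter (\<lambda>x. \<not> x < r) p = [r..<r + s]"
    using filter_shuffles_disjoint1[OF disj p] by (simp_all add: not_less)
  then have "sorted_wrt (<) (filter (\<lambda>x. x < r) p)" "sorted_wrt (<) (filter (\<lambda>x. \<not> x < r) p)"
    by simp_all
  then have "sorted_wrt (\<lambda>x y. (x < r \<and> y < r) \<or> (r \<le> x \<and> r \<le> y) \<longrightarrow> x < y) p"
    unfolding sorted_wrt_filter_iff unfolding sorted_wrt_iff_nth_less by (meson not_less)
  ultimately show ?R by blast
next
  assume p: ?R
  have *: "filter P p = [a..<b]" if "{x. x < r + s \<and> P x} = {a..<b}"
    "\<And>x y. P x \<Longrightarrow> P y \<Longrightarrow> (x < r \<and> y < r) \<or> (r \<le> x \<and> r \<le> y)" for P a b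
  proof (rule strict_sorted_equal)
    show "sorted_wrt (<) (filter P p)"
      unfolding sorted_wrt_filter_iff
      by (rule sorted_wrt_mono_rel[OF _ conjunct2[OF conjunct2[OF p]]]) (use that(2) in blast)
    show "set (filter P p) = set [a..<b]"
      using that(1) by (auto simp: p)
  qed auto
  have "filter (\<lambda>x. x < r) p = [0..<r]" "filter (\<lambda>x. \<not> x < r) p = [r..<r + s]"
    by (rule *; auto)+
  then show ?L using partition_in_shuffles[of p "\<lambda>x. x < r"] by simp
qed

text \<open>The list of \<open>inv \<sigma>\<close> names the label placed at each position. So
  \<open>\<sigma>\<close> increases on a block exactly if the labels of that block appear in
  increasing order.\<close>

lemma is_shuffle_iff_shuffles:
  assumes "\<sigma> permutes {..<r + s}"
  shows "is_shuffle r s \<sigma> \<longleftrightarrow> map (inv \<sigma>) [0..<r + s] \<in> shuffles [0..<r] [r..<r + s]"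
proof -
  define R where "R = (\<lambda>x y. (x < r \<and> y < r) \<or> (r \<le> x \<and> r \<le> y) \<longrightarrow> x < (y :: nat))"
  have inv: "inv \<sigma> permutes {..<r + s}" using assms by (rule permutes_inv)
  have "distinct (map (inv \<sigma>) [0..<r + s])"
    using permutes_inj_on[OF inv] by (simp add: distinct_map)
  moreover have "set (map (inv \<sigma>) [0..<r + s]) = {..<r + s}"
    using permutes_image[OF inv] by (simp add: lessThan_atLeast0)
  ultimately have "map (inv \<sigma>) [0..<r + s] \<in> shuffles [0..<r] [r..<r + s] \<longleftrightarrow>
      (\<forall>j<r + s. \<forall>i<j. R (inv \<sigma> i) (inv \<sigma> j))"
    by (auto simp: shuffles_upt_iff R_def sorted_wrt_iff_nth_less)
  also have "\<dots> \<longleftrightarrow> (\<forall>x<r + s. \<forall>y<r + s. \<sigma> x < \<sigma> y \<longrightarrow> R x y)"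
    (is "?A \<longleftrightarrow> ?B")
  proof
    assume ?A
    show ?B
    proof (intro allI impI)
      fix x y assume "x < r + s" "y < r + s" "\<sigma> x < \<sigma> y"
      moreover from this have "\<sigma> y < r + s" using permutes_in_image[OF assms, of y] by simp
      ultimately have "R (inv \<sigma> (\<sigma> x)) (inv \<sigma> (\<sigma> y))" using \<open>?A\<close> by blast
      then show "R x y" by (simp add: permutes_inverses[OF assms])
    qed
  next
    assume ?B
    show ?A
    proof (intro allI impI)
      fix i j assume "j < r + s" "i < j"
      moreover have "inv \<sigma> i < r + s" "inv \<sigma> j < r + s"
        using permutes_in_image[OF inv, of i] permutes_in_image[OF inv, of j] calculation by auto
      moreover have "\<sigma> (inv \<sigma> i) < \<sigma> (inv \<sigma> j)"
        using calculation by (simp add: permutes_inverses[OF assms])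
      ultimately show "R (inv \<sigma> i) (inv \<sigma> j)" using \<open>?B\<close> by blast
    qed
  qed
  also have "\<dots> \<longleftrightarrow> strict_mono_on {..<r} \<sigma> \<and> strict_mono_on {r..<r + s} \<sigma>" (is "_ \<longleftrightarrow> ?C")
  proof
    assume B: ?B
    have mono: "\<sigma> x < \<sigma> y" if "x < y" "y < r \<or> r \<le> x" "y < r + s" for x y
    proof (rule ccontr)
      assume "\<not> \<sigma> x < \<sigma> y"
      moreover have "\<sigma> x \<noteq> \<sigma> y" using permutes_inj[OF assms] that(1) by (auto dest: injD)
      ultimately have "R y x" using B that by auto
      then show False using that by (auto simp: R_def)
    qed
    show ?C by (intro conjI strict_mono_onI mono) auto
  next
    assume C: ?C
    show ?B
    proof (intro allI impI)
      fix x y assume xy: "x < r + s" "y < r + s" "\<sigma> x < \<sigma> y"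
      show "R x y"
      proof (rule ccontr)
        assume "\<not> R x y"
        then have "y \<le> x" "(x < r \<and> y < r) \<or> (r \<le> x \<and> r \<le> y)" by (auto simp: R_def)
        moreover have "x \<noteq> y" using xy by auto
        ultimately have "\<sigma> y < \<sigma> x"
          using C xy by (auto dest!: strict_mono_onD[of _ \<sigma> y x])
        then show False using xy by simp
      qed
    qed
  qed
  finally show ?thesis using assms by (simp add: is_shuffle_def)
qed

lemma bij_betw_is_shuffle:
  "bij_betw (\<lambda>\<sigma>. map (inv \<sigma>) [0..<r + s]) {\<sigma>. is_shuffle r s \<sigma>} (shuffles [0..<r] [r..<r + s])"
proof (rule bij_betw_imageI)
  show "inj_on (\<lambda>\<sigma>. map (inv \<sigma>) [0..<r + s]) {\<sigma>. is_shuffle r s \<sigma>}"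
  proof (rule inj_onI)
    fix \<sigma> \<rho>
    assume "\<sigma> \<in> {\<sigma>. is_shuffle r s \<sigma>}" "\<rho> \<in> {\<sigma>. is_shuffle r s \<sigma>}"
      and eq: "map (inv \<sigma>) [0..<r + s] = map (inv \<rho>) [0..<r + s]"
    then have perm: "\<sigma> permutes {..<r + s}" "\<rho> permutes {..<r + s}"
      by (auto simp: is_shuffle_def)
    \<comment> \<open>Both permutations are the identity beyond \<open>r + s\<close>, so the list
      determines the inverse everywhere.\<close>
    have "inv \<sigma> j = inv \<rho> j" for j
      using eq permutes_not_in[OF permutes_inv[OF perm(1)], of j]
        permutes_not_in[OF permutes_inv[OF perm(2)], of j]
      by (cases "j < r + s") auto
    then have "inv \<sigma> = inv \<rho>" by blast
    then show "\<sigma> = \<rho>" by (metis perm permutes_inv_inv)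
  qed
  show "(\<lambda>\<sigma>. map (inv \<sigma>) [0..<r + s]) ` {\<sigma>. is_shuffle r s \<sigma>} = shuffles [0..<r] [r..<r + s]"
  proof (intro equalityI subsetI)
    fix p assume p: "p \<in> shuffles [0..<r] [r..<r + s]"
    then have p': "distinct p" "set p = {..<r + s}" by (auto simp: shuffles_upt_iff)
    have len: "length p = r + s" using length_shuffles[OF p] by simp
    \<comment> \<open>The list read as a function and extended by the identity; the required shuffle
      is its inverse.\<close>
    define \<pi> where "\<pi> = (\<lambda>j. if j < r + s then p ! j else j)"
    have "bij_betw \<pi> {..<r + s} {..<r + s}"
      by (subst bij_betw_cong[where g = "(!) p"], simp add: \<pi>_def,
          rule bij_betw_nth[OF p'(1)]) (simp_all only: len p'(2))
    then have \<pi>: "\<pi> permutes {..<r + s}"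
      by (rule bij_imp_permutes) (auto simp: \<pi>_def)
    have "map (inv (inv \<pi>)) [0..<r + s] = p"
      unfolding permutes_inv_inv[OF \<pi>] using len by (intro nth_equalityI) (auto simp: \<pi>_def)
    with p show "p \<in> (\<lambda>\<sigma>. map (inv \<sigma>) [0..<r + s]) ` {\<sigma>. is_shuffle r s \<sigma>}"
      using is_shuffle_iff_shuffles[OF permutes_inv[OF \<pi>]] by (intro image_eqI[of _ _ "inv \<pi>"]) auto
  qed (use is_shuffle_iff_shuffles in \<open>auto simp: is_shuffle_def\<close>)
qed

section \<open>Binary sequences and the series Li\<close>

lemma snoc_induct2 [consumes 1, case_names Nil snoc]:
  assumes "length ys = length xs" and "P [] []"
    and "\<And>x xs y ys. length ys = length xs \<Longrightarrow> P xs ys \<Longrightarrow> P (xs @ [x]) (ys @ [y])"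
  shows "P xs ys"
  using assms(1) by (induction xs ys rule: rev_induct2) (use assms(2,3) in auto)

definition bs_word :: "bi_index \<Rightarrow> (nat \<times> rat) list" where
  "bs_word km = rev (zip (fst (bs km)) (snd (bs km)))"

lemma successive_diffs_snoc:
  "successive_diffs (m @ [b]) = successive_diffs m @ [b - (if m = [] then 0 else last m)]"
  by (auto simp: successive_diffs_def nth_append last_conv_nth)

lemma length_successive_diffs [simp]: "length (successive_diffs m) = length m"
  by (simp add: successive_diffs_def)

text \<open>Ensures that the \<open>zip\<close> in \<open>bs_word\<close> truncates nothing.\<close>

lemma length_snd_bs:
  assumes "length m = length k"
  shows "length (snd (bs (k, m))) = length (fst (bs (k, m)))"
proof -
  have "length (concat (map2 (\<lambda>ki d. d # replicate (ki - 1) 0) k ds)) =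
      length (concat (map (\<lambda>ki. (1 :: nat) # replicate (ki - 1) 0) k))"
    if "length k = length ds" for ds :: "rat list"
    using that by (induction k ds rule: list_induct2) auto
  from this[of "successive_diffs m"] assms show ?thesis by simp
qed

lemma bs_eq_bs_word:
  assumes "length m = length k"
  shows "bs (k, m) = (map fst (rev (bs_word (k, m))), map snd (rev (bs_word (k, m))))"
  using length_snd_bs[OF assms] by (simp add: bs_word_def del: bs.simps)

lemma bs_word_Nil [simp]: "bs_word ([], []) = []"
  by (simp add: bs_word_def)

lemma bs_word_snoc_last:
  assumes "length m = length k"
  shows "bs_word (k @ [a], m @ [b]) =
    replicate (a - 1) (0, 0) @ (1, b - (if m = [] then 0 else last m)) # bs_word (k, m)"
  using assms length_snd_bs[OF assms]
  by (simp add: bs_word_def successive_diffs_snoc zip_replicate)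

text \<open>The successive differences telescope.\<close>

lemma weight_bs_word:
  "length m = length k \<Longrightarrow> weight (bs_word (k, m)) = (if m = [] then 0 else last m)"
  by (induction k m rule: snoc_induct2) (auto simp: bs_word_snoc_last)

lemma bs_word_snoc:
  assumes "length m = length k"
  shows "bs_word (k @ [a], m @ [b]) =
    replicate (a - 1) (0, 0) @ (1, b - weight (bs_word (k, m))) # bs_word (k, m)"
  using assms by (simp only: bs_word_snoc_last weight_bs_word)

lemma admissible_replicate:
  "admissible w \<Longrightarrow> 0 < weight w \<Longrightarrow> admissible (replicate n (0, 0) @ w)"
  by (induction n) auto

lemma admissible_bs_word:
  "length m = length k \<Longrightarrow> \<forall>x\<in>set m. 0 < x \<Longrightarrow> admissible (bs_word (k, m))"
  by (induction k m rule: snoc_induct2) (auto simp: bs_word_snoc intro!: admissible_replicate)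

text \<open>Read the sequence from its start: a letter \<open>(1, d)\<close> opens a new entry of
  \<open>k\<close>, and each \<open>(0, 0)\<close> raises the last entry by one. The entries of
  \<open>m\<close> are partial weights.\<close>

lemma admissible_imp_bs_word:
  assumes "admissible w"
  shows "\<exists>k m. length m = length k \<and> (\<forall>x\<in>set k. 1 \<le> x) \<and> (\<forall>x\<in>set m. 0 < x) \<and> w = bs_word (k, m)"
  using assms
proof (induction w)
  case Nil
  show ?case by (intro exI[of _ "[]"]) auto
next
  case (Cons a w)
  then obtain k m where km: "length m = length k" "\<forall>x\<in>set k. 1 \<le> x" "\<forall>x\<in>set m. 0 < x"
    "w = bs_word (k, m)"
    by auto
  show ?case
  proof (cases "fst a = 1")
    case True
    \<comment> \<open>The new entry of \<open>m\<close> is the weight reached so far; it exceeds the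
      weight of \<open>w\<close> by exactly \<open>snd a\<close>.\<close>
    then have "a # w = bs_word (k @ [1], m @ [weight (a # w)])"
      using km(1,4) by (simp add: bs_word_snoc prod_eq_iff)
    moreover have "0 < weight (a # w)" using Cons.prems by simp
    ultimately show ?thesis
      using km(1-3) by (intro exI[of _ "k @ [1]"] exI[of _ "m @ [weight (a # w)]"]) (simp del: weight_simps)
  next
    case False
    with Cons.prems have a: "a = (0, 0)" and "0 < weight w" by auto
    \<comment> \<open>The empty word has weight 0, so there is a last entry of \<open>k\<close> for
      the zero to extend.\<close>
    then have "k \<noteq> []" using km by auto
    then obtain k' c where k: "k = k' @ [c]" by (metis rev_exhaust)
    obtain m' b where m: "m = m' @ [b]" using km(1) \<open>k \<noteq> []\<close> by (metis length_0_conv rev_exhaust)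
    have len: "length m' = length k'" using km(1) k m by simp
    obtain c' where "c = Suc c'" using km(2) k by (cases c) auto
    then have "a # w = bs_word (k' @ [Suc c], m)"
      using km(4) a by (simp add: k m bs_word_snoc[OF len])
    with km show ?thesis
      by (intro exI[of _ "k' @ [Suc c]"] exI[of _ m]) (auto simp: k)
  qed
qed

lemma replicate_append_Cons_inject:
  assumes "replicate i z @ y # r = replicate j z @ y' # r'" "y \<noteq> z" "y' \<noteq> z"
  shows "i = j \<and> y = y' \<and> r = r'"
  using assms
proof (induction i arbitrary: j)
  case 0
  then show ?case by (cases j) auto
next
  case (Suc i)
  then show ?case by (cases j) auto
qed

text \<open>The leading zeros stop at the first letter with 1. This separates the last entries from
  the word of the shorter bi-index.\<close>

lemma bs_word_inject:
  assumes "length m = length k" "length m' = length k'"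
    and "\<forall>x\<in>set k. 1 \<le> x" "\<forall>x\<in>set k'. 1 \<le> x" "bs_word (k, m) = bs_word (k', m')"
  shows "k = k' \<and> m = m'"
  using assms
proof (induction k m arbitrary: k' m' rule: snoc_induct2)
  case Nil
  then show ?case
    by (cases k' rule: rev_exhaust; cases m' rule: rev_exhaust) (auto simp: bs_word_snoc)
next
  case (snoc a k b m)
  show ?case
  proof (cases k' rule: rev_exhaust)
    case Nil
    with snoc.prems snoc.hyps show ?thesis by (auto simp: bs_word_snoc)
  next
    case k': (snoc k'' a')
    then obtain m'' b' where m': "m' = m'' @ [b']"
      using snoc.prems(1) by (metis length_0_conv rev_exhaust snoc_eq_iff_butlast)
    have len: "length m'' = length k''" using snoc.prems(1) k' m' by simp
    have *: "a - 1 = a' - 1 \<and> (1 :: nat, b - weight (bs_word (k, m))) = (1, b' - weight (bs_word (k'', m''))) \<and>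
        bs_word (k, m) = bs_word (k'', m'')"
      by (rule replicate_append_Cons_inject[where z = "(0, 0)"])
        (use snoc.prems(4) in \<open>simp_all add: k' m' bs_word_snoc len snoc.hyps\<close>)
    moreover have "k = k'' \<and> m = m''"
      using * snoc.prems len by (intro snoc.IH) (auto simp: k')
    \<comment> \<open>Truncated subtraction in \<open>a - 1\<close> identifies 0 with 1; this bound
      gives \<open>a = a'\<close>.\<close>
    moreover have "1 \<le> a" "1 \<le> a'" using snoc.prems by (auto simp: k')
    ultimately show ?thesis by (auto simp: k' m')
  qed
qed

section \<open>Coefficients of word series as nested sums\<close>

lemma word_fps_nth_replicate:
  "fps_nth (word_fps \<mu> (replicate j (0, 0) @ w)) n =
    fps_nth (word_fps \<mu> w) n / (of_nat n * \<mu> + of_rat (weight w)) ^ j"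
  by (induction j) (auto simp: letter_fps_def)

text \<open>The geometric factor turns coefficients into partial sums, which is the condition that
  earlier indices are at most \<open>n\<close>. The letter with 1 and its \<open>a - 1\<close> zeros
  all see the weight \<open>b\<close>, hence the power \<open>a\<close>.\<close>

lemma word_fps_nth_bs_word_snoc:
  assumes "length m = length k" "1 \<le> a"
  shows "fps_nth (word_fps \<mu> (bs_word (k @ [a], m @ [b]))) n =
    (\<Sum>j\<le>n. fps_nth (word_fps \<mu> (bs_word (k, m))) j) * (\<mu> / (of_nat n * \<mu> + of_rat b) ^ a)"
proof -
  let ?f = "word_fps \<mu> (bs_word (k, m))"
  have "fps_nth (letter_fps \<mu> (1, b - weight (bs_word (k, m))) * ?f) n = \<mu> * (\<Sum>j\<le>n. fps_nth ?f j)"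
  proof -
    have "fps_nth (?f * Abs_fps (\<lambda>_. 1)) n = (\<Sum>j\<le>n. fps_nth ?f j)"
      by (simp add: fps_mult_nth atLeast0AtMost)
    then show ?thesis by (simp add: letter_fps_def mult.assoc mult.commute[of "Abs_fps (\<lambda>_. 1)"])
  qed
  moreover obtain a' where "a = Suc a'" using assms(2) by (cases a) auto
  ultimately show ?thesis
    using assms by (simp add: bs_word_snoc word_fps_nth_replicate)
qed

definition sorted_lists_upto :: "nat \<Rightarrow> nat \<Rightarrow> nat list set" where
  "sorted_lists_upto r N = {ns. length ns = r \<and> sorted ns \<and> set ns \<subseteq> {..N}}"

lemma finite_sorted_lists_upto [simp]: "finite (sorted_lists_upto r N)"
  by (rule finite_subset[OF _ finite_lists_length_eq[of "{..N}" r]])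
    (auto simp: sorted_lists_upto_def)

lemma card_sorted_lists_upto: "card (sorted_lists_upto r N) \<le> Suc N ^ r"
proof -
  have "card (sorted_lists_upto r N) \<le> card {ns. set ns \<subseteq> {..N} \<and> length ns = r}"
    by (rule card_mono) (auto simp: sorted_lists_upto_def finite_lists_length_eq)
  then show ?thesis by (simp add: card_lists_length_eq)
qed

text \<open>Groups sorted lists by their last entry. \<open>J\<close> is \<open>{..N}\<close> for
  partial sums and \<open>UNIV\<close> for the whole series.\<close>

lemma bij_betw_sorted_snoc:
  "bij_betw (\<lambda>(j, ns). ns @ [j]) (SIGMA j:J. sorted_lists_upto r j)
     {ns. length ns = Suc r \<and> sorted ns \<and> last ns \<in> J}"
proof (rule bij_betw_byWitness[where f' = "\<lambda>ns. (last ns, butlast ns)"])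
  show "(\<lambda>ns. (last ns, butlast ns)) ` {ns. length ns = Suc r \<and> sorted ns \<and> last ns \<in> J}
      \<subseteq> (SIGMA j:J. sorted_lists_upto r j)"
  proof (intro image_subsetI)
    fix ns assume ns: "ns \<in> {ns. length ns = Suc r \<and> sorted ns \<and> last ns \<in> J}"
    then obtain xs j where "ns = xs @ [j]" by (cases ns rule: rev_exhaust) auto
    with ns show "(last ns, butlast ns) \<in> (SIGMA j:J. sorted_lists_upto r j)"
      by (auto simp: sorted_lists_upto_def sorted_append)
  qed
qed (auto simp: sorted_lists_upto_def sorted_append intro!: append_butlast_last_id)

lemma sorted_lists_upto_Suc:
  "sorted_lists_upto (Suc r) N = {ns. length ns = Suc r \<and> sorted ns \<and> last ns \<in> {..N}}"
proof (intro set_eqI)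
  fix ns :: "nat list"
  show "ns \<in> sorted_lists_upto (Suc r) N \<longleftrightarrow>
      ns \<in> {ns. length ns = Suc r \<and> sorted ns \<and> last ns \<in> {..N}}"
    by (cases ns rule: rev_exhaust) (auto simp: sorted_lists_upto_def sorted_append)
qed

text \<open>The summand of \<open>Li\<close> without the power of \<open>t\<close>, the only factor
  that refers to \<open>last\<close>.\<close>

definition Li_term :: "complex \<Rightarrow> nat list \<Rightarrow> rat list \<Rightarrow> nat list \<Rightarrow> complex" where
  "Li_term \<mu> k m ns =
     \<mu> ^ length k / (\<Prod>i<length k. (of_nat (ns ! i) * \<mu> + of_rat (m ! i)) ^ (k ! i))"

lemma Li_term_snoc:
  assumes "length m = length k" "length ns = length k"
  shows "Li_term \<mu> (k @ [a]) (m @ [b]) (ns @ [j]) =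
    Li_term \<mu> k m ns * (\<mu> / (of_nat j * \<mu> + of_rat b) ^ a)"
  using assms by (simp add: Li_term_def nth_append)

text \<open>Partial sums, unlike single coefficients, also make sense at depth 0, where there is no last
  summation index.\<close>

lemma sum_Li_term:
  assumes "length m = length k" "\<forall>x\<in>set k. 1 \<le> x"
  shows "(\<Sum>ns\<in>sorted_lists_upto (length k) N. Li_term \<mu> k m ns) =
    (\<Sum>j\<le>N. fps_nth (word_fps \<mu> (bs_word (k, m))) j)"
  using assms
proof (induction k m arbitrary: N rule: snoc_induct2)
  case Nil
  have "sorted_lists_upto 0 N = {[]}" by (auto simp: sorted_lists_upto_def)
  then show ?case by (simp add: Li_term_def sum.delta' flip: of_bool_def)
next
  case (snoc a k b m)
  have "(\<Sum>ns\<in>sorted_lists_upto (length (k @ [a])) N. Li_term \<mu> (k @ [a]) (m @ [b]) ns) =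
      (\<Sum>(j, ns)\<in>(SIGMA j:{..N}. sorted_lists_upto (length k) j). Li_term \<mu> (k @ [a]) (m @ [b]) (ns @ [j]))"
    using sum.reindex_bij_betw[OF bij_betw_sorted_snoc[of "{..N}" "length k"],
        of "Li_term \<mu> (k @ [a]) (m @ [b])"]
    by (simp add: sorted_lists_upto_Suc split_def)
  also have "\<dots> = (\<Sum>j\<le>N. \<Sum>ns\<in>sorted_lists_upto (length k) j. Li_term \<mu> (k @ [a]) (m @ [b]) (ns @ [j]))"
    by (rule sum.Sigma[symmetric]) auto
  also have "\<dots> = (\<Sum>j\<le>N. (\<Sum>ns\<in>sorted_lists_upto (length k) j. Li_term \<mu> k m ns) *
      (\<mu> / (of_nat j * \<mu> + of_rat b) ^ a))"
    unfolding sum_distrib_right using snoc.hyps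
    by (intro sum.cong refl Li_term_snoc) (auto simp: sorted_lists_upto_def)
  \<comment> \<open>The induction hypothesis is used with bound \<open>j\<close> for each inner sum;
    this is why \<open>N\<close> is kept arbitrary.\<close>
  also have "\<dots> = (\<Sum>j\<le>N. fps_nth (word_fps \<mu> (bs_word (k @ [a], m @ [b]))) j)"
    using snoc by (simp add: word_fps_nth_bs_word_snoc)
  finally show ?case .
qed

section \<open>Absolute convergence and the power series expansion of Li\<close>

lemma norm_Li_term_le:
  assumes "0 \<le> Re \<mu>" "length m = length k" "\<forall>x\<in>set m. 0 < x"
  shows "norm (Li_term \<mu> k m ns) \<le> norm \<mu> ^ length k / (\<Prod>i<length k. of_rat (m ! i) ^ (k ! i))"
proof -
  have pos: "(0 :: real) < of_rat (m ! i)" if "i < length k" for i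
    using assms(2,3) that by simp
  have "(\<Prod>i<length k. of_rat (m ! i) ^ (k ! i)) \<le>
      (\<Prod>i<length k. norm (of_nat (ns ! i) * \<mu> + of_rat (m ! i)) ^ (k ! i))"
    using pos by (intro prod_mono conjI power_mono denominator_norm assms(1)) (auto intro: less_imp_le)
  moreover have "(0 :: real) < (\<Prod>i<length k. of_rat (m ! i) ^ (k ! i))"
    using pos by (intro prod_pos) auto
  ultimately show ?thesis
    by (simp add: Li_term_def norm_divide norm_power prod_norm[symmetric] frac_le)
qed

text \<open>Termwise differentiation turns the coefficients \<open>(n+1)^r\<close> into
  \<open>(n+1)(n+2)^r\<close>, which dominate \<open>(n+1)^(r+1)\<close>, and preserves convergence
  in the unit disc.\<close>

lemma summable_Suc_power_mult_power:
  fixes x :: real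
  assumes "\<bar>x\<bar> < 1"
  shows "summable (\<lambda>n. real (Suc n) ^ r * x ^ n)"
  using assms
proof (induction r arbitrary: x)
  case 0
  then show ?case by (simp add: summable_geometric)
next
  case (Suc r)
  let ?c = "\<lambda>n. real (Suc n) ^ r"
  have "summable (\<lambda>n. diffs ?c n * \<bar>x\<bar> ^ n)"
    by (rule termdiff_converges[where K = 1]) (use Suc in auto)
  moreover have "norm (real (Suc n) ^ Suc r * x ^ n) \<le> diffs ?c n * \<bar>x\<bar> ^ n" for n
    by (auto simp: diffs_def abs_mult power_abs intro!: mult_right_mono mult_left_mono power_mono)
  ultimately show ?case by (rule summable_comparison_test')
qed

text \<open>Absolute convergence allows grouping the multiple series by its last index; the terms
  with last index \<open>j\<close> add up to coefficient \<open>j\<close> times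
  \<open>x^j\<close>.\<close>

lemma Li_sums:
  assumes "0 < Re \<mu>" "positive_bi_index km" "0 < t" "t < 1"
  defines "x \<equiv> complex_of_real t powr \<mu>"
  shows "summable (\<lambda>n. norm (fps_nth (word_fps \<mu> (bs_word km)) n * x ^ n))" (is ?summable)
    and "(\<lambda>n. fps_nth (word_fps \<mu> (bs_word km)) n * x ^ n) sums Li \<mu> km t" (is ?sums)
proof -
  obtain k a m b where km: "km = (k @ [a], m @ [b])" and len: "length m = length k"
    and k_ge: "\<forall>x\<in>set (k @ [a]). 1 \<le> x" and m_pos: "\<forall>x\<in>set (m @ [b]). 0 < x"
  proof -
    obtain k0 m0 where "km = (k0, m0)" by (cases km)
    with assms(2) that show ?thesis
      by (cases k0 rule: rev_exhaust; cases m0 rule: rev_exhaust) auto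
  qed
  let ?c = "fps_nth (word_fps \<mu> (bs_word km))"
  let ?r = "length k"
  let ?S = "SIGMA j:UNIV. sorted_lists_upto ?r j"
  define h where "h = (\<lambda>(j, ns). Li_term \<mu> (k @ [a]) (m @ [b]) (ns @ [j]) * x ^ j)"
  define K where "K = norm \<mu> ^ length (k @ [a]) / (\<Prod>i<length (k @ [a]). of_rat ((m @ [b]) ! i) ^ ((k @ [a]) ! i))"
  have Re: "0 \<le> Re \<mu>" using assms(1) by simp
  \<comment> \<open>The modulus of \<open>t powr \<mu>\<close> is
    \<open>t powr Re \<mu>\<close>.\<close>
  have norm_x: "norm x < 1"
    using powr_less_mono2[of "Re \<mu>" t 1] assms(1,3,4) by (simp add: x_def norm_powr_real_powr)
  have norm_h: "norm (h (j, ns)) \<le> K * norm x ^ j" for j ns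
  proof -
    have "norm (Li_term \<mu> (k @ [a]) (m @ [b]) (ns @ [j])) \<le> K"
      unfolding K_def by (rule norm_Li_term_le[OF Re _ m_pos]) (simp add: len)
    then show ?thesis by (auto simp: h_def norm_mult norm_power intro!: mult_right_mono)
  qed
  have "0 \<le> K"
    unfolding K_def
    by (rule order_trans[OF norm_ge_zero norm_Li_term_le[OF Re _ m_pos]]) (simp add: len)
  have sum_h: "(\<Sum>ns\<in>sorted_lists_upto ?r j. h (j, ns)) = ?c j * x ^ j" for j
  proof -
    have "(\<Sum>ns\<in>sorted_lists_upto ?r j. h (j, ns)) =
        (\<Sum>ns\<in>sorted_lists_upto ?r j. Li_term \<mu> k m ns) * (\<mu> / (of_nat j * \<mu> + of_rat b) ^ a) * x ^ j"
      unfolding sum_distrib_right h_def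
      by (intro sum.cong refl) (auto simp: sorted_lists_upto_def Li_term_snoc len)
    then show ?thesis
      using sum_Li_term[OF len, of \<mu> j] k_ge by (simp add: km word_fps_nth_bs_word_snoc[OF len])
  qed
  \<comment> \<open>At most \<open>(j+1)^(length k)\<close> lists belong to \<open>j\<close>, and
    each term is bounded by \<open>K\<close> times the \<open>j\<close>-th power of
    \<open>norm x\<close>.\<close>
  have summable_norm_h: "summable (\<lambda>j. \<Sum>ns\<in>sorted_lists_upto ?r j. norm (h (j, ns)))"
  proof (rule summable_comparison_test')
    show "summable (\<lambda>j. K * (real (Suc j) ^ ?r * norm x ^ j))"
      using norm_x by (intro summable_mult summable_Suc_power_mult_power) simp
    fix j
    have "(\<Sum>ns\<in>sorted_lists_upto ?r j. norm (h (j, ns))) \<le>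
        real (card (sorted_lists_upto ?r j)) * (K * norm x ^ j)"
      using norm_h by (intro sum_bounded_above)
    also have "\<dots> \<le> real (Suc j ^ ?r) * (K * norm x ^ j)"
      using card_sorted_lists_upto[of ?r j] \<open>0 \<le> K\<close>
      by (intro mult_right_mono) (auto simp del: of_nat_power of_nat_Suc)
    finally show "norm (\<Sum>ns\<in>sorted_lists_upto ?r j. norm (h (j, ns))) \<le> K * (real (Suc j) ^ ?r * norm x ^ j)"
      by (simp add: sum_nonneg mult_ac)
  qed
  have "(\<lambda>z. norm (h z)) summable_on ?S"
    using summable_norm_h
    by (subst Infinite_Sum.abs_summable_on_Sigma_iff)
      (auto simp: sum_nonneg summable_on_UNIV_nonneg_real_iff)
  then have h_summable: "h summable_on ?S" by (rule abs_summable_summable)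
  show ?summable
  proof (rule summable_comparison_test'[OF summable_norm_h])
    fix j
    show "norm (norm (?c j * x ^ j)) \<le> (\<Sum>ns\<in>sorted_lists_upto ?r j. norm (h (j, ns)))"
      unfolding sum_h[symmetric] by (simp add: norm_sum)
  qed
  have "Li \<mu> km t = (\<Sum>\<^sub>\<infinity>ns\<in>{ns. length ns = Suc ?r \<and> sorted ns \<and> last ns \<in> UNIV}.
      Li_term \<mu> (k @ [a]) (m @ [b]) ns * x ^ last ns)"
    by (simp add: km Li_term_def x_def)
  also have "\<dots> = infsum h ?S"
    by (subst infsum_reindex_bij_betw[OF bij_betw_sorted_snoc, symmetric])
      (simp add: h_def split_def)
  also have "\<dots> = (\<Sum>\<^sub>\<infinity>j. ?c j * x ^ j)"
    using infsum_Sigma_banach[OF h_summable] by (simp add: sum_h)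
  finally have "Li \<mu> km t = (\<Sum>\<^sub>\<infinity>j. ?c j * x ^ j)" .
  with norm_summable_imp_summable_on[OF \<open>?summable\<close>] show ?sums
    by (auto intro: has_sum_imp_sums)
qed

section \<open>The shuffle product formula\<close>

lemma card_Collect_bij_betw:
  assumes "bij_betw f A B"
  shows "card {x \<in> A. P (f x)} = card {y \<in> B. P y}"
proof (rule bij_betw_same_card)
  show "bij_betw f {x \<in> A. P (f x)} {y \<in> B. P y}"
    using assms by (auto simp: bij_betw_def inj_on_def)
qed

lemma map_nth_map_append:
  assumes "\<And>j. j \<in> set js \<Longrightarrow> \<pi> j < length xs + length ys"
  shows "map (\<lambda>j. (map h xs @ map h ys) ! \<pi> j) js = map h (map ((!) (xs @ ys)) (map \<pi> js))"
proof -
  have "(map h xs @ map h ys) ! \<pi> j = h ((xs @ ys) ! \<pi> j)" if "j \<in> set js" for j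
    using assms[OF that] unfolding map_append[symmetric] by (subst nth_map) auto
  then show ?thesis by simp
qed

text \<open>Permutations are traded for interleavings of positions, which \<open>g\<close> turns
  into letters. The reversal matches the reversed words.\<close>

lemma shuffle_count_bs:
  fixes km1 km2 km :: bi_index
  assumes "positive_bi_index km1" "positive_bi_index km2" "positive_bi_index km"
  defines "r \<equiv> length (bs_word km1)" and "s \<equiv> length (bs_word km2)"
    and "g \<equiv> (!) (rev (bs_word km1) @ rev (bs_word km2))"
  shows "shuffle_count (bs km1) (bs km2) (bs km) =
    card {p \<in> shuffles (rev [0..<r]) (rev [r..<r + s]). bs_word km = map g p}"
proof -
  have bs: "bs \<kappa> = (map fst (rev (bs_word \<kappa>)), map snd (rev (bs_word \<kappa>)))"
    if "positive_bi_index \<kappa>" for \<kappa>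
    using that by (cases \<kappa>) (simp add: bs_eq_bs_word del: bs.simps)
  have iff: "map fst (rev (bs_word km)) = map (\<lambda>j. (map fst (rev (bs_word km1)) @ map fst (rev (bs_word km2))) ! inv \<sigma> j) [0..<r + s] \<and>
      map snd (rev (bs_word km)) = map (\<lambda>j. (map snd (rev (bs_word km1)) @ map snd (rev (bs_word km2))) ! inv \<sigma> j) [0..<r + s] \<longleftrightarrow>
      bs_word km = map g (rev (map (inv \<sigma>) [0..<r + s]))"
    if "is_shuffle r s \<sigma>" for \<sigma>
  proof -
    have "inv \<sigma> permutes {..<r + s}" using that by (simp add: is_shuffle_def permutes_inv)
    then have bound: "inv \<sigma> j < r + s" if "j < r + s" for j
      using permutes_in_image[of "inv \<sigma>" "{..<r + s}" j] that by simp
    have nth: "map (\<lambda>j. (map fst (rev (bs_word km1)) @ map fst (rev (bs_word km2))) ! inv \<sigma> j) [0..<r + s] =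
        map fst (map g (map (inv \<sigma>) [0..<r + s]))"
      "map (\<lambda>j. (map snd (rev (bs_word km1)) @ map snd (rev (bs_word km2))) ! inv \<sigma> j) [0..<r + s] =
        map snd (map g (map (inv \<sigma>) [0..<r + s]))"
      unfolding g_def by (rule map_nth_map_append; use bound in \<open>simp add: r_def s_def\<close>)+
    have "bs_word km = map g (rev (map (inv \<sigma>) [0..<r + s])) \<longleftrightarrow>
        rev (bs_word km) = map g (map (inv \<sigma>) [0..<r + s])"
      by (simp only: rev_map[symmetric] rev_swap)
    also have "\<dots> \<longleftrightarrow> map fst (rev (bs_word km)) = map fst (map g (map (inv \<sigma>) [0..<r + s])) \<and>
        map snd (rev (bs_word km)) = map snd (map g (map (inv \<sigma>) [0..<r + s]))"
      by (metis zip_map_fst_snd)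
    finally show ?thesis unfolding nth by blast
  qed
  have "shuffle_count (bs km1) (bs km2) (bs km) =
      card {\<sigma> \<in> {\<sigma>. is_shuffle r s \<sigma>}. bs_word km = map g (rev (map (inv \<sigma>) [0..<r + s]))}"
    unfolding bs[OF assms(1)] bs[OF assms(2)] bs[OF assms(3)] shuffle_count.simps
    by (rule arg_cong[where f = card]) (use iff in \<open>auto simp: r_def s_def\<close>)
  also have "\<dots> = card {p \<in> shuffles [0..<r] [r..<r + s]. bs_word km = map g (rev p)}"
    by (rule card_Collect_bij_betw[OF bij_betw_is_shuffle])
  also have "\<dots> = card {p \<in> shuffles (rev [0..<r]) (rev [r..<r + s]). bs_word km = map g p}"
    by (rule card_Collect_bij_betw[OF bij_betw_rev_shuffles]) auto
  finally show ?thesis .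
qed

theorem theorem2p20:
  fixes \<mu> :: complex and km1 km2 :: bi_index and t :: real
  assumes "0 < Re \<mu>"
    and "positive_bi_index km1" and "positive_bi_index km2"
    and "0 < t" and "t < 1"
  shows "finite {km. positive_bi_index km \<and>
           of_nat (shuffle_count (bs km1) (bs km2) (bs km)) * Li \<mu> km t \<noteq> 0} \<and>
         Li \<mu> km1 t * Li \<mu> km2 t =
           (\<Sum>\<^sub>\<infinity> km \<in> {km. positive_bi_index km}.
              of_nat (shuffle_count (bs km1) (bs km2) (bs km)) * Li \<mu> km t)"
proof -
  let ?u = "bs_word km1" and ?v = "bs_word km2"
  define r where "r = length ?u"
  define s where "s = length ?v"
  define g where "g = (!) (rev ?u @ rev ?v)"
  define T where "T = shuffles (rev [0..<r]) (rev [r..<r + s])"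
  define x where "x = complex_of_real t powr \<mu>"
  have "finite T" by (simp add: T_def)
  have Re: "0 \<le> Re \<mu>" using assms(1) by simp
  have "map g [0..<r] = rev ?u" "map g [r..<r + s] = rev ?v"
    by (auto simp: g_def r_def s_def nth_append intro!: nth_equalityI)
  then have map_g: "map g (rev [0..<r]) = ?u" "map g (rev [r..<r + s]) = ?v"
    by (simp_all flip: rev_map)
  have adm: "admissible ?u" "admissible ?v"
    using assms(2,3) by (cases km1, cases km2, auto simp: admissible_bs_word)+
  \<comment> \<open>Keeps the empty word out of the shuffles, so that the bi-indices found below
    have depth at least 1.\<close>
  have "?u \<noteq> []"
    using assms(2) by (cases km1, cases "fst km1" rule: rev_exhaust; cases "snd km1" rule: rev_exhaust)
      (auto simp: bs_word_snoc)
  have "\<exists>\<kappa>. positive_bi_index \<kappa> \<and> bs_word \<kappa> = map g p" if "p \<in> T" for p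
  proof -
    have p: "map g p \<in> shuffles ?u ?v"
      using map_in_shuffles[OF that[unfolded T_def], of g] by (simp only: map_g)
    obtain k m where km: "length m = length k" "\<forall>x\<in>set k. 1 \<le> x" "\<forall>x\<in>set m. 0 < x"
      "map g p = bs_word (k, m)"
      using admissible_imp_bs_word[OF admissible_shuffles[OF p adm]] by blast
    have "k \<noteq> []"
    proof
      assume "k = []"
      then have "[] \<in> shuffles ?u ?v" using p km by simp
      with \<open>?u \<noteq> []\<close> show False by simp
    qed
    with km show ?thesis by (intro exI[of _ "(k, m)"]) auto
  qed
  \<comment> \<open>\<open>\<kappa>\<close> need not be injective: its fibre over \<open>km\<close>
    has exactly as many elements as the shuffle count.\<close>
  then obtain \<kappa> where \<kappa>: "positive_bi_index (\<kappa> p)" "bs_word (\<kappa> p) = map g p" if "p \<in> T" for p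
    by metis
  have \<kappa>_eq: "bs_word km = map g p \<longleftrightarrow> \<kappa> p = km" if "positive_bi_index km" "p \<in> T" for km p
  proof
    assume "bs_word km = map g p"
    then show "\<kappa> p = km"
      using that \<kappa>[OF that(2)] bs_word_inject[of "snd km" "fst km" "snd (\<kappa> p)" "fst (\<kappa> p)"]
      by (cases km; cases "\<kappa> p") auto
  qed (use \<kappa> that in auto)
  have count: "shuffle_count (bs km1) (bs km2) (bs km) = card {p \<in> T. \<kappa> p = km}"
    if "positive_bi_index km" for km
    unfolding shuffle_count_bs[OF assms(2,3) that] using \<kappa>_eq[OF that]
    by (intro arg_cong[where f = card]) (auto simp: T_def r_def s_def g_def)
  have zero: "of_nat (shuffle_count (bs km1) (bs km2) (bs km)) * Li \<mu> km t = 0"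
    if "positive_bi_index km" "km \<notin> \<kappa> ` T" for km
  proof -
    have "{p \<in> T. \<kappa> p = km} = {}" using that(2) by auto
    with count[OF that(1)] show ?thesis by simp
  qed
  have "finite {km. positive_bi_index km \<and>
           of_nat (shuffle_count (bs km1) (bs km2) (bs km)) * Li \<mu> km t \<noteq> 0}"
    by (rule finite_subset[OF _ finite_imageI[OF \<open>finite T\<close>, of \<kappa>]]) (use zero in blast)
  moreover have "Li \<mu> km1 t * Li \<mu> km2 t = (\<Sum>p\<in>T. Li \<mu> (\<kappa> p) t)"
  \<comment> \<open>One series is summed in two ways: as the Cauchy product of two absolutely
    convergent expansions and as a finite sum of expansions.\<close>
  proof (rule sums_unique2)
    let ?c = "\<lambda>km. fps_nth (word_fps \<mu> (bs_word km))"
    note Li = Li_sums[OF assms(1) _ assms(4,5), folded x_def]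
    have "word_fps \<mu> ?u * word_fps \<mu> ?v = (\<Sum>p\<in>T. word_fps \<mu> (map g p))"
      using word_fps_mult[OF Re, of g "rev [0..<r]" "rev [r..<r + s]"] adm
      unfolding map_g T_def by auto
    also have "\<dots> = (\<Sum>p\<in>T. word_fps \<mu> (bs_word (\<kappa> p)))"
      using \<kappa> by simp
    finally have eq: "word_fps \<mu> ?u * word_fps \<mu> ?v = (\<Sum>p\<in>T. word_fps \<mu> (bs_word (\<kappa> p)))" .
    have "(\<Sum>i\<le>n. (?c km1 i * x ^ i) * (?c km2 (n - i) * x ^ (n - i))) =
        (\<Sum>p\<in>T. ?c (\<kappa> p) n * x ^ n)" for n
    proof -
      have "(\<Sum>i\<le>n. (?c km1 i * x ^ i) * (?c km2 (n - i) * x ^ (n - i))) =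
          (\<Sum>i\<le>n. ?c km1 i * ?c km2 (n - i)) * x ^ n"
        unfolding sum_distrib_right
        by (intro sum.cong refl) (simp add: power_add[symmetric] mult_ac)
      also have "\<dots> = fps_nth (word_fps \<mu> ?u * word_fps \<mu> ?v) n * x ^ n"
        by (simp add: fps_mult_nth atLeast0AtMost)
      also have "\<dots> = (\<Sum>p\<in>T. ?c (\<kappa> p) n * x ^ n)"
        unfolding eq by (simp add: fps_sum_nth sum_distrib_right)
      finally show ?thesis .
    qed
    then show "(\<lambda>n. \<Sum>p\<in>T. ?c (\<kappa> p) n * x ^ n) sums (Li \<mu> km1 t * Li \<mu> km2 t)"
      using Cauchy_product_sums[OF Li(1)[OF assms(2)] Li(1)[OF assms(3)]]
        Li(2)[OF assms(2)] Li(2)[OF assms(3)] by (simp add: sums_iff)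
    show "(\<lambda>n. \<Sum>p\<in>T. ?c (\<kappa> p) n * x ^ n) sums (\<Sum>p\<in>T. Li \<mu> (\<kappa> p) t)"
      by (intro sums_sum Li(2) \<kappa>(1))
  qed
  moreover have "(\<Sum>\<^sub>\<infinity> km \<in> {km. positive_bi_index km}.
      of_nat (shuffle_count (bs km1) (bs km2) (bs km)) * Li \<mu> km t) = (\<Sum>p\<in>T. Li \<mu> (\<kappa> p) t)"
  proof -
    \<comment> \<open>Terms outside the image of \<open>\<kappa>\<close> vanish. On the image each
      multiplicity is the size of a fibre, so the sum unfolds to one over \<open>T\<close>.\<close>
    have "(\<Sum>\<^sub>\<infinity> km \<in> {km. positive_bi_index km}.
        of_nat (shuffle_count (bs km1) (bs km2) (bs km)) * Li \<mu> km t) =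
        (\<Sum>\<^sub>\<infinity> km \<in> \<kappa> ` T. of_nat (card {p \<in> T. \<kappa> p = km}) * Li \<mu> km t)"
      by (rule infsum_cong_neutral) (use \<kappa>(1) zero count in \<open>auto simp del: positive_bi_index.simps bs.simps Li.simps\<close>)
    also have "\<dots> = (\<Sum>km\<in>\<kappa> ` T. \<Sum>p\<in>{p \<in> T. \<kappa> p = km}. Li \<mu> (\<kappa> p) t)"
      using \<open>finite T\<close> by simp
    also have "\<dots> = (\<Sum>p\<in>T. Li \<mu> (\<kappa> p) t)"
      by (rule sum.image_gen[OF \<open>finite T\<close>, symmetric])
    finally show ?thesis .
  qed
  ultimately show ?thesis by simp
qed

end
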